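(* Let $n\ge 4$ and let $P$ be a convex $n$-gon in the Euclidean plane with consecutive vertices $V_1,\dots,V_n$ (indices understood cyclically modulo $n$). Then $P$ has at least 4 extremal triples of vertices, i.e. there are at least 4 indices $i\in\mathbb{Z}/n$ for which the triple $(V_i,V_{i+1},V_{i+2})$ is extremal.
   Context: A triple of consecutive vertices $(V_i,V_{i+1},V_{i+2})$ is called extremal if $V_{i-1}$ and $V_{i+3}$ lie on the same side of the circle through $V_i,V_{i+1},V_{i+2}$; this does not exclude the case when $V_{i-1}$ or $V_{i+3}$ belongs to the circle (so the triple counts as extremal whenever at least one of $V_{i-1},V_{i+3}$ lies on the circle, or both lie strictly inside, or both lie strictly outside). As usual, the vertices of a convex $n$-gon are its $n$ distinct corners, so no three vertices are collinear. For $n=4$ one has $V_{i-1}=V_{i+3}$. *)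

theory Defs
  imports "HOL-Analysis.Analysis"
begin

text \<open>
  The vertices of an n-gon are indexed cyclically by the residues 0, ..., n - 1, so that only the
  values of \<open>V\<close> below \<open>n\<close> matter.
\<close>

definition cyc :: "nat \<Rightarrow> (nat \<Rightarrow> 'a) \<Rightarrow> nat \<Rightarrow> 'a" where
  "cyc n V i = V (i mod n)"

text \<open>
  The corners of \<open>P\<close> are exactly the n distinct points \<open>V i\<close>, and they are listed consecutively:
  any two cyclically adjacent ones span an edge of \<open>P\<close>. Either sense of rotation is allowed.
  No three vertices are collinear, because every vertex is an extreme point.
\<close>

definition convex_ngon :: "nat \<Rightarrow> (real ^ 2) set \<Rightarrow> (nat \<Rightarrow> real ^ 2) \<Rightarrow> bool" where
  "convex_ngon n P V \<longleftrightarrow>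
     polytope P \<and> aff_dim P = 2 \<and>
     inj_on V {..<n} \<and>
     {x. x extreme_point_of P} = V ` {..<n} \<and>
     (\<forall>i<n. closed_segment (cyc n V i) (cyc n V (i + 1)) edge_of P)"

text \<open>
  Here \<open>sphere c r\<close> is a circle of the plane, and a point on it counts as being on the same
  side as any other point.
\<close>

definition same_side_of_circle :: "real ^ 2 \<Rightarrow> real \<Rightarrow> real ^ 2 \<Rightarrow> real ^ 2 \<Rightarrow> bool" where
  "same_side_of_circle c r A B \<longleftrightarrow>
     A \<in> sphere c r \<or> B \<in> sphere c r \<or>
     (A \<in> ball c r \<and> B \<in> ball c r) \<or>
     (A \<notin> cball c r \<and> B \<notin> cball c r)"

text \<open>
  The vertices of a convex polygon are not collinear, so the circle \<open>sphere c r\<close> below exists and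
  is unique. The index \<open>i + (n - 1)\<close> stands for i - 1 modulo n.
\<close>

definition extremal_triple :: "nat \<Rightarrow> (nat \<Rightarrow> real ^ 2) \<Rightarrow> nat \<Rightarrow> bool" where
  "extremal_triple n V i \<longleftrightarrow>
     (\<exists>c r. {cyc n V i, cyc n V (i + 1), cyc n V (i + 2)} \<subseteq> sphere c r \<and>
            same_side_of_circle c r (cyc n V (i + (n - 1))) (cyc n V (i + 3)))"

end

theory Submission
  imports Defs
begin

text \<open>
  Let \<open>g\<^sub>i\<close> be the power of a point with respect to the circle through the vertices \<open>i\<close>, \<open>i + 1\<close>,
  \<open>i + 2\<close>, and let \<open>l\<^sub>i\<close> be the affine function cutting out edge \<open>i\<close>, positive inside the polygon.
  Then \<open>g\<^bsub>i-1\<^esub> - g\<^sub>i = b\<^sub>i l\<^sub>i\<close> for some number \<open>b\<^sub>i\<close>, the triple \<open>i\<close> is extremal iff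
  \<open>b\<^sub>i b\<^bsub>i+1\<^esub> \<le> 0\<close>, and summation over a period gives \<open>\<Sum> b\<^sub>i l\<^sub>i = 0\<close>. With fewer than four extremal
  triples, some edge \<open>t\<close> can be deleted so that the remaining \<open>b\<^sub>i\<close> change sign at most once. Some point
  of the projective line through edge \<open>t\<close> gives the remaining \<open>l\<^sub>i\<close> the same sign pattern, so all
  these \<open>b\<^sub>i\<close> vanish, and then all triples are extremal.
\<close>

section \<open>Sign changes of cyclic sequences\<close>

lemma mod_add_neq:
  fixes i j n d :: nat
  assumes "0 < d" "d < n"
  shows "(j + d) mod n \<noteq> j mod n"
proof
  assume "(j + d) mod n = j mod n"
  then have "n dvd d" using mod_eq_dvd_iff_nat[of j "j + d" n] by simp
  then show False using assms by (auto dest: dvd_imp_le)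
qed

lemma sgn_eq_if_mult_pos:
  fixes a b :: real
  assumes "0 < a * b"
  shows "sgn a = sgn b"
  using assms by (auto simp: zero_less_mult_iff)

lemma sgn_const_if_mult_pos:
  fixes f :: "nat \<Rightarrow> real"
  assumes "\<And>k. a \<le> k \<Longrightarrow> k < c \<Longrightarrow> 0 < f k * f (Suc k)" and "a \<le> k" "k \<le> c"
  shows "sgn (f k) = sgn (f a)"
  using assms(2,3)
proof (induction k rule: dec_induct)
  case base
  then show ?case by simp
next
  case (step k)
  then show ?case using sgn_eq_if_mult_pos[OF assms(1)[of k]] by simp
qed

text \<open>A pair containing a zero counts as a sign change, so \<open>sgn (f k)\<close> is
  constant between changes and at most one change leaves at most two blocks. \<open>m\<close> ends
  the first block; \<open>m = n - 1\<close> leaves the second one empty.\<close>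

lemma split_at_sign_change:
  fixes f :: "nat \<Rightarrow> real"
  assumes "2 \<le> n" and few: "card {k \<in> {1..n - 2}. f k * f (k + 1) \<le> 0} \<le> 1"
  obtains m s where "1 \<le> m" "m \<le> n - 1" "s \<noteq> 0"
    "\<And>k. 1 \<le> k \<Longrightarrow> k \<le> m \<Longrightarrow> s * f k \<le> 0"
    "\<And>k. m < k \<Longrightarrow> k \<le> n - 1 \<Longrightarrow> 0 \<le> s * f k"
proof -
  define E where "E = {k \<in> {1..n - 2}. f k * f (k + 1) \<le> 0}"
  have fin: "finite E" unfolding E_def by simp
  show thesis
  proof (cases "E = {}")
    case True
    have pos: "0 < f k * f (Suc k)" if "1 \<le> k" "k < n - 1" for k
    proof -
      have "k \<in> {1..n - 2}" "k \<notin> E" using that True by auto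
      then show ?thesis unfolding E_def by simp
    qed
    have c: "sgn (f k) = sgn (f 1)" if "1 \<le> k" "k \<le> n - 1" for k
      using sgn_const_if_mult_pos[of 1 "n - 1" f k] pos that by blast
    define s :: real where "s = (if f 1 \<le> 0 then 1 else -1)"
    have "s * f k \<le> 0" if "1 \<le> k" "k \<le> n - 1" for k
      using c[OF that] by (auto simp: s_def sgn_if split: if_splits)
    then show thesis using that[of "n - 1" s] assms(1) by (force simp: s_def)
  next
    case False
    then obtain m where m: "m \<in> E" by blast
    have pos: "0 < f k * f (Suc k)" if "1 \<le> k" "k < n - 1" "k \<noteq> m" for k
    proof -
      have "k \<notin> E" using few fin m that(3) unfolding E_def[symmetric]
        by (auto simp: card_le_Suc0_iff_eq)
      moreover have "k \<in> {1..n - 2}" using that by auto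
      ultimately show ?thesis unfolding E_def by simp
    qed
    have m1: "1 \<le> m" "m \<le> n - 2" "f m * f (Suc m) \<le> 0" using m by (auto simp: E_def)
    have c1: "sgn (f k) = sgn (f m)" if "1 \<le> k" "k \<le> m" for k
    proof -
      have "sgn (f j) = sgn (f 1)" if "1 \<le> j" "j \<le> m" for j
      proof (rule sgn_const_if_mult_pos[OF _ that])
        fix i assume "1 \<le> i" "i < m"
        then show "0 < f i * f (Suc i)" using m1(2) by (intro pos) auto
      qed
      from this[OF that] this[OF m1(1) order_refl] show ?thesis by (rule trans[OF _ sym])
    qed
    have c2: "sgn (f k) = sgn (f (Suc m))" if "m < k" "k \<le> n - 1" for k
      using sgn_const_if_mult_pos[of "Suc m" "n - 1" f k] pos that m1 by simp
    define s :: real where "s = (if f m \<le> 0 \<and> 0 \<le> f (Suc m) then 1 else -1)"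
    have "s * f k \<le> 0" if "1 \<le> k" "k \<le> m" for k
      using c1[OF that] m1(3)
      by (auto simp: s_def sgn_if mult_le_0_iff split: if_splits)
    moreover have "0 \<le> s * f k" if "m < k" "k \<le> n - 1" for k
      using c2[OF that] m1(3)
      by (auto simp: s_def sgn_if mult_le_0_iff split: if_splits)
    ultimately show thesis using that[of m s] m1 by (force simp: s_def)
  qed
qed

lemma periodic_mod:
  fixes f :: "nat \<Rightarrow> 'a"
  assumes "\<And>i. f (i + n) = f i"
  shows "f (i mod n) = f i"
proof -
  have "f (r + q * n) = f r" for q r
    by (induction q) (simp_all add: assms add.assoc[symmetric] add.commute[of n])
  from this[of "i mod n" "i div n"] show ?thesis by simp
qed

text \<open>Over a period, the product of all \<open>f i * f (i + 1)\<close> is the square of the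
  product of all \<open>f i\<close>, hence positive, while each sign change contributes a negative
  factor.\<close>

lemma even_sign_changes:
  fixes f :: "nat \<Rightarrow> real"
  assumes per: "\<And>i. f (i + n) = f i" and nz: "\<And>i. f i \<noteq> 0"
  shows "even (card {i \<in> {..<n}. f i * f (i + 1) \<le> 0})"
proof -
  define E where "E = {i \<in> {..<n}. f i * f (i + 1) \<le> 0}"
  have shift: "(\<Prod>i<n. f (i + 1)) = (\<Prod>i<n. f i)"
  proof (cases n)
    case 0
    then show ?thesis by simp
  next
    case (Suc m)
    have "f n = f 0" using per[of 0] by simp
    then have "(\<Prod>i<n. f (i + 1)) = f 0 * (\<Prod>i<m. f (Suc i))" by (simp add: Suc)
    also have "\<dots> = (\<Prod>i<n. f i)" by (simp only: Suc prod.lessThan_Suc_shift)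
    finally show ?thesis .
  qed
  have "0 < (\<Prod>i<n. f i) * (\<Prod>i<n. f i)"
    using nz by (simp add: zero_less_mult_iff linorder_neq_iff[symmetric] flip: power2_eq_square)
  also have "\<dots> = (\<Prod>i<n. f i * f (i + 1))" using shift by (simp add: prod.distrib)
  finally have "1 = sgn (\<Prod>i<n. f i * f (i + 1))" by simp
  also have "\<dots> = (\<Prod>i<n. sgn (f i * f (i + 1)))"
    by (induction n) (simp_all add: sgn_mult)
  also have "\<dots> = (\<Prod>i<n. if i \<in> E then - 1 else 1)"
  proof (rule prod.cong)
    fix i assume "i \<in> {..<n}"
    moreover have "f i * f (i + 1) \<noteq> 0" using nz by simp
    ultimately show "sgn (f i * f (i + 1)) = (if i \<in> E then - 1 else 1)"
      unfolding E_def sgn_if by auto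
  qed simp
  also have "\<dots> = (- 1) ^ card E"
  proof -
    have "{..<n} \<inter> {i. i \<in> E} = E" by (auto simp: E_def)
    then show ?thesis by (simp add: prod.If_cases)
  qed
  finally show ?thesis
    unfolding E_def[symmetric] by (metis minus_one_power_iff one_neq_neg_one)
qed

text \<open>
  Deleting the entry \<open>f t\<close> destroys the two pairs containing it. With three sign changes both of
  these must be sign changes, which is possible because by parity some entry vanishes.
\<close>

lemma deletion_leaves_one_sign_change:
  fixes f :: "nat \<Rightarrow> real"
  assumes "2 \<le> n" and per: "\<And>i. f (i + n) = f i"
    and few: "card {i \<in> {..<n}. f i * f (i + 1) \<le> 0} \<le> 3"
  obtains t where "card {k \<in> {1..n - 2}. f (t + k) * f (t + k + 1) \<le> 0} \<le> 1"
proof -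
  define E where "E = {i \<in> {..<n}. f i * f (i + 1) \<le> 0}"
  have fin: "finite E" unfolding E_def by simp
  have memE: "i mod n \<in> E \<longleftrightarrow> f i * f (i + 1) \<le> 0" for i
  proof -
    have "f (j + n + 1) = f (j + 1)" for j using per[of "j + 1"] by (simp add: add_ac)
    then show ?thesis
      using periodic_mod[of f, OF per] periodic_mod[of "\<lambda>j. f (j + 1)" n i] assms(1)
      by (simp add: E_def)
  qed
  \<comment> \<open>The two pairs containing entry \<open>t\<close> start at \<open>t\<close> and at
    its cyclic predecessor \<open>t + (n - 1)\<close>.\<close>
  have "\<exists>t. card (E - {t mod n, (t + (n - 1)) mod n}) \<le> 1"
  proof (cases "card E = 3")
    case True
    then have "\<exists>t. f t = 0" using even_sign_changes[of f n, OF per] unfolding E_def by force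
    then obtain t where t: "f t = 0" by blast
    have "t mod n \<in> E" using t memE[of t] by simp
    moreover have "(t + (n - 1)) mod n \<in> E"
      using t memE[of "t + (n - 1)"] per[of t] assms(1) by simp
    moreover have "t mod n \<noteq> (t + (n - 1)) mod n"
      using mod_add_neq[of "n - 1" n t] assms(1) by simp
    ultimately have "card (E - {t mod n, (t + (n - 1)) mod n}) = 1"
      using True by (simp add: card_Diff_subset)
    then show ?thesis by (intro exI[of _ t]) simp
  next
    case False
    then have le2: "card E \<le> 2" using few unfolding E_def by simp
    show ?thesis
    proof (cases "E = {}")
      case True
      then show ?thesis by simp
    next
      case False
      then obtain t where t: "t \<in> E" by blast
      then have "t mod n \<in> E" by (simp add: E_def)
      then have "card (E - {t mod n}) \<le> 1" using le2 fin by simp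
      moreover have "card (E - {t mod n, (t + (n - 1)) mod n}) \<le> card (E - {t mod n})"
        using fin by (intro card_mono) auto
      ultimately show ?thesis by (intro exI[of _ t]) linarith
    qed
  qed
  then obtain t where t: "card (E - {t mod n, (t + (n - 1)) mod n}) \<le> 1" by blast
  define A where "A = {k \<in> {1..n - 2}. f (t + k) * f (t + k + 1) \<le> 0}"
  have neq: "(t + k) mod n \<noteq> (t + l) mod n" if "k < l" "l < n" for k l
    using mod_add_neq[of "l - k" n "t + k"] that by fastforce
  have "inj_on (\<lambda>k. (t + k) mod n) A"
  proof (rule inj_onI)
    fix k l assume kl: "k \<in> A" "l \<in> A" "(t + k) mod n = (t + l) mod n"
    then have "k < n" "l < n" by (auto simp: A_def)
    then show "k = l" using neq kl(3) by (metis linorder_neqE_nat)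
  qed
  moreover have "(\<lambda>k. (t + k) mod n) ` A \<subseteq> E - {t mod n, (t + (n - 1)) mod n}"
  proof
    fix i assume "i \<in> (\<lambda>k. (t + k) mod n) ` A"
    then obtain k where k: "k \<in> A" "i = (t + k) mod n" by blast
    then have "0 < k" "k < n - 1" "f (t + k) * f (t + k + 1) \<le> 0" by (auto simp: A_def)
    then show "i \<in> E - {t mod n, (t + (n - 1)) mod n}"
      using k(2) memE[of "t + k"] neq[of 0 k] neq[of k "n - 1"] by fastforce
  qed
  ultimately have "card A \<le> card (E - {t mod n, (t + (n - 1)) mod n})"
    using fin by (intro card_inj_on_le) auto
  then show thesis using that[of t] t unfolding A_def by linarith
qed

text \<open>The ratios \<open>y k / x k\<close> increase strictly. The cross-multiplied form still
  makes sense when the last \<open>x\<close> vanishes; the induction cancels the positive middle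
  value \<open>x m\<close>.\<close>

lemma cross_ratio_chain:
  fixes x y :: "nat \<Rightarrow> real"
  assumes step: "\<And>k. 1 \<le> k \<Longrightarrow> k + 1 < n \<Longrightarrow> y k * x (k + 1) < y (k + 1) * x k"
    and pos: "\<And>k. 1 \<le> k \<Longrightarrow> k + 1 < n \<Longrightarrow> 0 < x k" and last: "0 \<le> x (n - 1)"
    and "1 \<le> k" "k < l" "l < n"
  shows "y k * x l < y l * x k"
  using \<open>k < l\<close> \<open>l < n\<close>
proof (induction l rule: less_induct)
  case (less l)
  show ?case
  proof (cases "l = k + 1")
    case True
    then show ?thesis using step[of k] assms less by simp
  next
    case False
    define m where "m = l - 1"
    have m: "l = m + 1" "k < m" "m < l" using less False by (auto simp: m_def)
    have ih: "y k * x m < y m * x k" using less.IH[of m] m less by simp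
    have st: "y m * x l < y l * x m" using step[of m] m less assms(4) by simp
    have xm: "0 < x m" and xk: "0 < x k" using pos m less assms(4) by auto
    have xl: "0 \<le> x l"
    proof (cases "l + 1 < n")
      case True
      then show ?thesis using pos[of l] m by simp
    next
      case False
      then have "l = n - 1" using less by simp
      then show ?thesis using last by simp
    qed
    have "x m * (y k * x l) \<le> x k * (y m * x l)"
      using mult_right_mono[OF less_imp_le[OF ih] xl] by (simp add: mult_ac)
    also have "\<dots> < x k * (y l * x m)" using st xk by simp
    finally have "x m * (y k * x l) < x m * (y l * x k)" by (simp add: mult_ac)
    then show ?thesis using xm by simp
  qed
qed

section \<open>Orientation and circles in the plane\<close>

text \<open>Twice the signed area of the triangle; for fixed distinct \<open>p\<close> and
  \<open>q\<close>, an affine function of \<open>r\<close> whose zero set is the line through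
  them.\<close>

definition orient :: "real ^ 2 \<Rightarrow> real ^ 2 \<Rightarrow> real ^ 2 \<Rightarrow> real" where
  "orient p q r = (q $ 1 - p $ 1) * (r $ 2 - p $ 2) - (q $ 2 - p $ 2) * (r $ 1 - p $ 1)"

lemma orient_rotate: "orient q r p = orient p q r"
  by (simp add: orient_def algebra_simps)

lemma orient_degenerate [simp]: "orient p q p = 0" "orient p q q = 0"
  by (simp_all add: orient_def algebra_simps)

text \<open>In homogeneous coordinates \<open>orient\<close> is a determinant, and the cross product
  of the lines \<open>a b\<close> and \<open>b c\<close> is \<open>orient a b c\<close> times the
  point \<open>b\<close>.\<close>

lemma orient_pluecker:
  "orient a b t * orient b c u - orient a b u * orient b c t = orient a b c * orient t u b"
  by (simp add: orient_def) algebra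

lemma affine_function_vanishing_on_line:
  fixes w :: "real ^ 2"
  assumes "w \<bullet> p + c = 0" "w \<bullet> q + c = 0"
  shows "(w \<bullet> x + c) * orient p q r = (w \<bullet> r + c) * orient p q x"
proof -
  \<comment> \<open>Interpolation in barycentric coordinates, with the denominator cleared.\<close>
  have "(w \<bullet> x + c) * orient p q r =
      (w \<bullet> p + c) * orient x q r + (w \<bullet> q + c) * orient p x r + (w \<bullet> r + c) * orient p q x"
    by (simp add: orient_def inner_vec_def sum_2) algebra
  then show ?thesis using assms by simp
qed

lemma circumcircle_exists:
  assumes "orient p q r \<noteq> 0"
  shows "\<exists>c. dist c q = dist c p \<and> dist c r = dist c p"
proof -
  define u where "u = q - p"
  define v where "v = r - p"
  define d where "d = 2 * orient p q r"
  \<comment> \<open>Cramer's rule for the centre \<open>w\<close> relative to \<open>p\<close>,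
    which has to satisfy \<open>2 * (u \<bullet> w) = u \<bullet> u\<close> and
    \<open>2 * (v \<bullet> w) = v \<bullet> v\<close>.\<close>
  define a where "a = (v $ 2 * (u \<bullet> u) - u $ 2 * (v \<bullet> v)) / d"
  define b where "b = (u $ 1 * (v \<bullet> v) - v $ 1 * (u \<bullet> u)) / d"
  define w :: "real ^ 2" where "w = vector [a, b]"
  have d: "d \<noteq> 0" "d = 2 * (u $ 1 * v $ 2 - u $ 2 * v $ 1)"
    using assms by (simp_all add: d_def u_def v_def orient_def)
  have w: "w $ 1 = a" "w $ 2 = b" by (simp_all add: w_def)
  have "2 * (u \<bullet> w) = u \<bullet> u"
  proof -
    have "d * (2 * (u \<bullet> w)) = 2 * (u $ 1 * (d * a) + u $ 2 * (d * b))"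
      by (simp add: inner_vec_def sum_2 w algebra_simps)
    also have "\<dots> = d * (u \<bullet> u)"
      using d(1) by (simp add: a_def b_def) (simp add: d(2) algebra_simps)
    finally show ?thesis using d(1) by simp
  qed
  moreover have "2 * (v \<bullet> w) = v \<bullet> v"
  proof -
    have "d * (2 * (v \<bullet> w)) = 2 * (v $ 1 * (d * a) + v $ 2 * (d * b))"
      by (simp add: inner_vec_def sum_2 w algebra_simps)
    also have "\<dots> = d * (v \<bullet> v)"
      using d(1) by (simp add: a_def b_def) (simp add: d(2) algebra_simps)
    finally show ?thesis using d(1) by simp
  qed
  ultimately have "norm (w - u) = norm w" "norm (w - v) = norm w"
    by (simp_all add: norm_eq inner_diff inner_commute)
  moreover have "dist (p + w) q = norm (w - u)" "dist (p + w) r = norm (w - v)"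
    "dist (p + w) p = norm w"
    by (simp_all add: dist_norm u_def v_def algebra_simps)
  ultimately show ?thesis by metis
qed

definition power_of_point :: "real ^ 2 \<Rightarrow> real \<Rightarrow> real ^ 2 \<Rightarrow> real" where
  "power_of_point c r x = (dist c x)\<^sup>2 - r\<^sup>2"

text \<open>The quadratic terms cancel; for distinct centres the zero set of the remaining affine
  function is the radical axis.\<close>

lemma power_of_point_diff:
  "power_of_point c r x - power_of_point c' r' x =
    (2 *\<^sub>R (c' - c)) \<bullet> x + (c \<bullet> c - c' \<bullet> c' - r\<^sup>2 + r'\<^sup>2)"
  by (simp add: power_of_point_def dist_norm power2_norm_eq_inner inner_diff inner_commute
      algebra_simps)

lemma same_side_if_power_mult_nonneg:
  assumes "0 \<le> r" and "0 \<le> power_of_point c r a * power_of_point c r b"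
  shows "same_side_of_circle c r a b"
proof -
  have "x \<in> sphere c r \<longleftrightarrow> power_of_point c r x = 0" for x
    using assms(1) power2_eq_iff_nonneg[of "dist c x" r] by (simp add: power_of_point_def)
  moreover have "x \<in> ball c r \<longleftrightarrow> power_of_point c r x < 0" for x
    using assms(1) power_mono_iff[of r "dist c x" 2] by (simp add: power_of_point_def flip: not_le)
  moreover have "x \<notin> cball c r \<longleftrightarrow> 0 < power_of_point c r x" for x
    using assms(1) power_mono_iff[of "dist c x" r 2] by (simp add: power_of_point_def flip: not_le)
  ultimately show ?thesis
    using assms(2) unfolding same_side_of_circle_def by (auto simp: zero_le_mult_iff)
qed

section \<open>Cyclically convex sequences of points\<close>

text \<open>Only the sign of \<open>s\<close> matters; it covers both senses of rotation. The
  offsets \<open>d\<close> run through all vertices off the edge from \<open>W i\<close> to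
  \<open>W (i + 1)\<close>.\<close>

locale convex_cycle =
  fixes n :: nat and W :: "nat \<Rightarrow> real ^ 2" and s :: real
  assumes n4: "4 \<le> n" and periodic: "W (i + n) = W i"
    and convex: "2 \<le> d \<Longrightarrow> d < n \<Longrightarrow> 0 < s * orient (W i) (W (i + 1)) (W (i + d))"
begin

text \<open>
  The functionals \<open>orient (W (t + k)) (W (t + k + 1))\<close> of all edges except \<open>t\<close> are separated by a
  point of the projective line spanned by edge \<open>t\<close>, at which the functional of edge \<open>t\<close> vanishes.
\<close>

lemma separating_point:
  assumes "1 \<le> m" "m \<le> n - 1"
  obtains \<alpha> \<beta> where
    "\<And>k. 1 \<le> k \<Longrightarrow> k \<le> m \<Longrightarrow>
      s * (\<alpha> * orient (W (t + k)) (W (t + k + 1)) (W (t + 1)) +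
           \<beta> * orient (W (t + k)) (W (t + k + 1)) (W t)) < 0"
    "\<And>k. m < k \<Longrightarrow> k \<le> n - 1 \<Longrightarrow>
      0 < s * (\<alpha> * orient (W (t + k)) (W (t + k + 1)) (W (t + 1)) +
               \<beta> * orient (W (t + k)) (W (t + k + 1)) (W t))"
proof -
  \<comment> \<open>\<open>x k\<close> and \<open>y k\<close> are, up to the factor
    \<open>s\<close>, the values of the functional of edge \<open>t + k\<close> at the endpoints of
    edge \<open>t\<close>; their ratio locates the intersection of the two edge lines.\<close>
  define x where "x k = s * orient (W (t + k)) (W (t + k + 1)) (W t)" for k
  define y where "y k = s * orient (W (t + k)) (W (t + k + 1)) (W (t + 1))" for k
  have Wt: "W (t + k + (n - k)) = W t" if "k < n" for k using periodic[of t] that by simp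
  have Wt1: "W (t + k + (n + 1 - k)) = W (t + 1)" if "k < n" for k
    using periodic[of "t + 1"] that by (simp add: add_ac)
  have xpos: "0 < x k" if "1 \<le> k" "k + 1 < n" for k
    using convex[of "n - k" "t + k"] Wt[of k] that unfolding x_def by simp
  have xlast: "x (n - 1) = 0"
    using periodic[of t] n4 by (simp add: x_def)
  have ypos: "0 < y k" if "2 \<le> k" "k < n" for k
    using convex[of "n + 1 - k" "t + k"] Wt1[of k] that unfolding y_def by simp
  have y1: "y 1 = 0" by (simp add: y_def)
  have step: "y k * x (k + 1) < y (k + 1) * x k" if "1 \<le> k" "k + 1 < n" for k
  proof -
    \<comment> \<open>Consecutive edges share a vertex, so \<open>orient_pluecker\<close> factors
      the difference into two orientations, both positive after multiplication by
      \<open>s\<close>.\<close>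
    have "y (k + 1) * x k - y k * x (k + 1) =
        s\<^sup>2 * (orient (W (t + k)) (W (t + k + 1)) (W t) *
              orient (W (t + k + 1)) (W (t + k + 2)) (W (t + 1)) -
              orient (W (t + k)) (W (t + k + 1)) (W (t + 1)) *
              orient (W (t + k + 1)) (W (t + k + 2)) (W t))"
      by (simp add: x_def y_def power2_eq_square algebra_simps)
    also have "\<dots> = (s * orient (W (t + k)) (W (t + k + 1)) (W (t + k + 2))) *
        (s * orient (W t) (W (t + 1)) (W (t + k + 1)))"
      unfolding orient_pluecker by (simp add: power2_eq_square)
    also have "\<dots> > 0"
      using mult_pos_pos[OF convex[of 2 "t + k"] convex[of "k + 1" t]] n4 that
      by (simp add: add_ac)
    finally show ?thesis by simp
  qed
  have cross: "y k * x l < y l * x k" if "1 \<le> k" "k < l" "l < n" for k l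
    using cross_ratio_chain[of n y x k l] step xpos xlast that by simp
  show thesis
  proof (cases "m = n - 1")
    case True
    \<comment> \<open>All edges need the same sign here; minus the sum of the endpoints works, as
      \<open>x k\<close> and \<open>y k\<close> are nonnegative and never vanish together.\<close>
    have "s * (- 1 * orient (W (t + k)) (W (t + k + 1)) (W (t + 1)) +
           - 1 * orient (W (t + k)) (W (t + k + 1)) (W t)) < 0" if "1 \<le> k" "k \<le> m" for k
    proof -
      have "0 < x k + y k"
      proof (cases "k = 1")
        case True
        then show ?thesis using xpos[of 1] y1 n4 by simp
      next
        case False
        then have "0 < y k" using ypos[of k] that \<open>m = n - 1\<close> n4 by simp
        moreover have "k = n - 1 \<or> k + 1 < n" using that \<open>m = n - 1\<close> by linarith
        then have "0 \<le> x k" using xpos[of k] xlast that by (auto intro: less_imp_le)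
        ultimately show ?thesis by simp
      qed
      then show ?thesis by (simp add: x_def y_def algebra_simps)
    qed
    then show thesis using that[of "-1" "-1"] True by simp
  next
    case False
    then have m: "m + 1 < n" using assms by simp
    \<comment> \<open>The weights \<open>x j\<close> and \<open>- y j\<close> annihilate functional
      \<open>j\<close>. Adding those for \<open>m\<close> and \<open>m + 1\<close> gives a point
      strictly between the two intersections.\<close>
    define \<alpha> where "\<alpha> = x m + x (m + 1)"
    define \<beta> where "\<beta> = - (y m + y (m + 1))"
    have eq: "s * (\<alpha> * orient (W (t + k)) (W (t + k + 1)) (W (t + 1)) +
           \<beta> * orient (W (t + k)) (W (t + k + 1)) (W t)) =
        (y k * x m - y m * x k) + (y k * x (m + 1) - y (m + 1) * x k)" for k
    proof -
      have "s * (\<alpha> * orient (W (t + k)) (W (t + k + 1)) (W (t + 1)) +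
           \<beta> * orient (W (t + k)) (W (t + k + 1)) (W t)) = \<alpha> * y k + \<beta> * x k"
        by (simp add: x_def[of k] y_def[of k] algebra_simps)
      then show ?thesis by (simp add: \<alpha>_def \<beta>_def algebra_simps)
    qed
    show thesis
    proof (rule that[of \<alpha> \<beta>], unfold eq)
      fix k assume k: "1 \<le> k" "k \<le> m"
      have "y k * x m - y m * x k \<le> 0" using cross[of k m] k m by (cases "k = m") auto
      then show "(y k * x m - y m * x k) + (y k * x (m + 1) - y (m + 1) * x k) < 0"
        using cross[of k "m + 1"] k m by simp
    next
      fix k assume k: "m < k" "k \<le> n - 1"
      have "0 \<le> y k * x (m + 1) - y (m + 1) * x k"
        using less_imp_le[OF cross[of "m + 1" k]] k m by (cases "k = m + 1") simp_all
      then show "0 < (y k * x m - y m * x k) + (y k * x (m + 1) - y (m + 1) * x k)"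
        using cross[of m k] k m assms by (simp add: add_pos_nonneg)
    qed
  qed
qed

lemma edge_relation_sign_changes:
  fixes b :: "nat \<Rightarrow> real"
  assumes per: "\<And>i. b (i + n) = b i"
    and rel: "\<And>t x. (\<Sum>k<n. b (t + k) * orient (W (t + k)) (W (t + k + 1)) x) = 0"
  shows "4 \<le> card {i \<in> {..<n}. b i * b (i + 1) \<le> 0}"
proof (rule ccontr)
  assume "\<not> ?thesis"
  then have few: "card {i \<in> {..<n}. b i * b (i + 1) \<le> 0} \<le> 3" by simp
  obtain t where t: "card {k \<in> {1..n - 2}. b (t + k) * b (t + k + 1) \<le> 0} \<le> 1"
    using deletion_leaves_one_sign_change[of n b] per few n4 by auto
  then obtain m e where m: "1 \<le> m" "m \<le> n - 1" and e: "e \<noteq> 0"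
    and neg: "\<And>k. 1 \<le> k \<Longrightarrow> k \<le> m \<Longrightarrow> e * b (t + k) \<le> 0"
    and pos: "\<And>k. m < k \<Longrightarrow> k \<le> n - 1 \<Longrightarrow> 0 \<le> e * b (t + k)"
    using split_at_sign_change[of n "\<lambda>k. b (t + k)"] n4 by (auto simp: add.assoc)
  define l where "l k = orient (W (t + k)) (W (t + k + 1))" for k
  obtain \<alpha> \<beta> where
    lneg: "\<And>k. 1 \<le> k \<Longrightarrow> k \<le> m \<Longrightarrow> s * (\<alpha> * l k (W (t + 1)) + \<beta> * l k (W t)) < 0" and
    lpos: "\<And>k. m < k \<Longrightarrow> k \<le> n - 1 \<Longrightarrow> 0 < s * (\<alpha> * l k (W (t + 1)) + \<beta> * l k (W t))"
    using separating_point[OF m, of t] unfolding l_def by blast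
  define q where "q k = s * (\<alpha> * l k (W (t + 1)) + \<beta> * l k (W t))" for k
  \<comment> \<open>Both endpoints lie on edge \<open>t\<close>, so the deleted coefficient
    \<open>b t\<close>, whose sign is not controlled, drops out of the sum.\<close>
  have q0: "q 0 = 0" by (simp add: q_def l_def)
  have qneg: "q k < 0" if "1 \<le> k" "k \<le> m" for k using lneg that by (simp add: q_def)
  have qpos: "0 < q k" if "m < k" "k \<le> n - 1" for k using lpos that by (simp add: q_def)
  have "(\<Sum>k<n. e * b (t + k) * q k) =
      e * s * (\<alpha> * (\<Sum>k<n. b (t + k) * l k (W (t + 1))) + \<beta> * (\<Sum>k<n. b (t + k) * l k (W t)))"
    by (simp add: q_def sum_distrib_left sum.distrib[symmetric] algebra_simps)
  also have "\<dots> = 0" using rel[of t] by (simp add: l_def)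
  finally have sum0: "(\<Sum>k<n. e * b (t + k) * q k) = 0" .
  have nonneg: "0 \<le> e * b (t + k) * q k" if "k < n" for k
  proof -
    consider "k = 0" | "1 \<le> k" "k \<le> m" | "m < k" by linarith
    then show ?thesis
    proof cases
      case 1
      then show ?thesis using q0 by simp
    next
      case 2
      then show ?thesis using neg[of k] qneg[of k] by (simp add: mult_nonpos_nonpos)
    next
      case 3
      then show ?thesis using mult_nonneg_nonneg[OF pos[of k] less_imp_le[OF qpos[of k]]] that by simp
    qed
  qed
  have "e * b (t + k) * q k = 0" if "k < n" for k
    using sum0 nonneg that by (subst (asm) sum_nonneg_eq_0_iff) auto
  moreover have "q k \<noteq> 0" if "1 \<le> k" "k < n" for k
    using qneg[of k] qpos[of k] that by (cases "k \<le> m") fastforce+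
  ultimately have "b (t + k) = 0" if "1 \<le> k" "k < n" for k
    using e that by fastforce
  \<comment> \<open>The remaining products all vanish and so count as sign changes; there are
    \<open>n - 2 \<ge> 2\<close> of them, against the bound 1.\<close>
  then have "{k \<in> {1..n - 2}. b (t + k) * b (t + k + 1) \<le> 0} = {1..n - 2}" using n4 by auto
  then show False using t n4 by simp
qed

theorem four_extremal_triples:
  obtains E where "E \<subseteq> {..<n}" "4 \<le> card E"
    "\<And>i. i \<in> E \<Longrightarrow> \<exists>c r. {W i, W (i + 1), W (i + 2)} \<subseteq> sphere c r \<and>
        same_side_of_circle c r (W (i + (n - 1))) (W (i + 3))"
proof -
  have "\<exists>c. dist c (W (i + 1)) = dist c (W i) \<and> dist c (W (i + 2)) = dist c (W i)" for i
    using convex[of 2 i] n4 by (intro circumcircle_exists) auto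
  then obtain c0 where c0: "\<And>i. dist (c0 i) (W (i + 1)) = dist (c0 i) (W i)"
      "\<And>i. dist (c0 i) (W (i + 2)) = dist (c0 i) (W i)"
    by metis
  \<comment> \<open>Reducing the index makes the chosen centres periodic by construction.\<close>
  define c where "c i = c0 (i mod n)" for i
  define r where "r i = dist (c i) (W i)" for i
  have Wmod: "W (i mod n) = W i" "W (i mod n + k) = W (i + k)" for i k
  proof -
    have "W (j + n + k) = W (j + k)" for j using periodic[of "j + k"] by (simp add: add_ac)
    then show "W (i mod n) = W i" "W (i mod n + k) = W (i + k)"
      using periodic_mod[of W n i] periodic_mod[of "\<lambda>j. W (j + k)" n i] periodic by simp_all
  qed
  have on_sphere: "{W i, W (i + 1), W (i + 2)} \<subseteq> sphere (c i) (r i)" for i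
    using c0[of "i mod n"] unfolding c_def r_def Wmod by auto
  define g where "g i = power_of_point (c i) (r i)" for i
  have gper: "g (i + n) = g i" for i by (simp add: g_def r_def c_def periodic)
  have g0: "g i (W i) = 0" "g i (W (i + 1)) = 0" "g i (W (i + 2)) = 0" for i
    using on_sphere[of i] by (auto simp: g_def power_of_point_def)
  define l where "l i = orient (W i) (W (i + 1))" for i
  \<comment> \<open>\<open>i + (n - 1)\<close> stands for the predecessor of \<open>i\<close>. Since
    \<open>g i\<close> vanishes at \<open>W (i + 2)\<close>, the factor can be read off
    there.\<close>
  define b where "b i = g (i + (n - 1)) (W (i + 2)) / l i (W (i + 2))" for i
  have bper: "b (i + n) = b i" for i
    using gper[of "i + (n - 1)"] periodic[of i] periodic[of "i + 1"] periodic[of "i + 2"]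
    by (simp add: b_def l_def add_ac)
  text \<open>
    Two consecutive circles share two vertices, so that the difference of their power functions is
    an affine function vanishing on the edge between these vertices.
  \<close>
  have diff: "g (i + (n - 1)) x - g i x = b i * l i x" for i x
  proof -
    obtain w k where wk: "\<And>x. g (i + (n - 1)) x - g i x = w \<bullet> x + k"
      unfolding g_def power_of_point_diff by blast
    have "i + (n - 1) + 1 = i + n" "i + (n - 1) + 2 = i + 1 + n" using n4 by auto
    then have "g (i + (n - 1)) (W i) = 0" "g (i + (n - 1)) (W (i + 1)) = 0"
      using g0(2,3)[of "i + (n - 1)"] periodic by metis+
    then have "w \<bullet> W i + k = 0" "w \<bullet> W (i + 1) + k = 0"
      using g0(1,2)[of i] wk by (metis diff_zero)+
    from affine_function_vanishing_on_line[OF this, of x "W (i + 2)"]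
    have "(g (i + (n - 1)) x - g i x) * l i (W (i + 2)) =
        (g (i + (n - 1)) (W (i + 2)) - g i (W (i + 2))) * l i x"
      unfolding wk l_def .
    moreover have "l i (W (i + 2)) \<noteq> 0" using convex[of 2 i] n4 unfolding l_def by auto
    ultimately show ?thesis using g0(3)[of i] by (simp add: b_def field_simps)
  qed
  have rel: "(\<Sum>k<n. b (t + k) * l (t + k) x) = 0" for t x
  proof -
    have "b (t + k) * l (t + k) x = g (t + (n - 1) + k) x - g (t + (n - 1) + Suc k) x" for k
      using diff[of "t + k" x] gper[of "t + k"] n4 by (simp add: add_ac)
    then have "(\<Sum>k<n. b (t + k) * l (t + k) x) = g (t + (n - 1)) x - g (t + (n - 1) + n) x"
      using sum_lessThan_telescope'[of "\<lambda>k. g (t + (n - 1) + k) x" n] by simp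
    then show ?thesis using gper by simp
  qed
  have extremal: "same_side_of_circle (c i) (r i) (W (i + (n - 1))) (W (i + 3))"
    if "b i * b (i + 1) \<le> 0" for i
  proof -
    \<comment> \<open>The preceding circle passes through \<open>W (i + (n - 1))\<close> and the
      following one through \<open>W (i + 3)\<close>. Hence the product of the powers of these
      points is \<open>- b i * b (i + 1)\<close> times a number that convexity makes
      positive.\<close>
    have 1: "g i (W (i + (n - 1))) = - b i * l i (W (i + (n - 1)))"
      using diff[of i "W (i + (n - 1))"] g0(1)[of "i + (n - 1)"] by simp
    have "i + 1 + (n - 1) = i + n" using n4 by simp
    then have 2: "g i (W (i + 3)) = b (i + 1) * l (i + 1) (W (i + 3))"
      using diff[of "i + 1" "W (i + 3)"] g0(3)[of "i + 1"] gper[of i]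
      by (simp add: numeral_3_eq_3)
    have "0 < (s * l i (W (i + (n - 1)))) * (s * l (i + 1) (W (i + 3)))"
      using mult_pos_pos[OF convex[of "n - 1" i] convex[of 2 "i + 1"]] n4
      by (simp add: l_def numeral_3_eq_3)
    then have "0 < s\<^sup>2 * (l i (W (i + (n - 1))) * l (i + 1) (W (i + 3)))"
      by (simp add: power2_eq_square mult_ac)
    then have "0 < l i (W (i + (n - 1))) * l (i + 1) (W (i + 3))"
      by (simp add: zero_less_mult_iff)
    then have "b i * b (i + 1) * (l i (W (i + (n - 1))) * l (i + 1) (W (i + 3))) \<le> 0"
      using mult_nonpos_nonneg[OF that less_imp_le] by blast
    then have "0 \<le> g i (W (i + (n - 1))) * g i (W (i + 3))"
      unfolding 1 2 by (simp add: mult_ac)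
    then show ?thesis
      unfolding g_def by (intro same_side_if_power_mult_nonneg) (simp_all add: r_def)
  qed
  show thesis
  proof (rule that[of "{i \<in> {..<n}. b i * b (i + 1) \<le> 0}"])
    show "4 \<le> card {i \<in> {..<n}. b i * b (i + 1) \<le> 0}"
      using edge_relation_sign_changes[of b] bper rel unfolding l_def by blast
  qed (use extremal on_sphere in blast)+
qed

end

section \<open>Convex polygons\<close>

text \<open>The edge is an exposed face, cut out by a supporting line. All other extreme points lie
  strictly on one side of it, and \<open>orient p q\<close> is proportional to its affine
  function.\<close>

lemma edge_same_side:
  assumes "polytope P" "closed_segment p q edge_of P" "p \<noteq> q"
    and "x extreme_point_of P" "x \<notin> {p, q}" "y extreme_point_of P" "y \<notin> {p, q}"
  shows "0 < orient p q x * orient p q y"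
proof -
  have "closed_segment p q exposed_face_of P"
    using assms(1,2) exposed_face_of_polyhedron[OF polytope_imp_polyhedron]
    unfolding edge_of_def by blast
  then obtain a c where ac: "P \<subseteq> {z. a \<bullet> z \<le> c}" "closed_segment p q = P \<inter> {z. a \<bullet> z = c}"
    unfolding exposed_face_of_def by blast
  have pq: "p \<in> P" "q \<in> P" "a \<bullet> p = c" "a \<bullet> q = c"
    using ac(2) ends_in_segment by blast+
  have strict: "a \<bullet> z < c" if "z extreme_point_of P" "z \<notin> {p, q}" for z
  proof -
    have "z \<in> P" "z \<notin> open_segment p q"
      using that pq unfolding extreme_point_of_def by auto
    then have "z \<notin> P \<inter> {z. a \<bullet> z = c}"
      using that unfolding ac(2)[symmetric] open_segment_def by auto
    then show ?thesis using ac(1) \<open>z \<in> P\<close> by force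
  qed
  have proportional: "(a \<bullet> u - c) * orient p q v = (a \<bullet> v - c) * orient p q u" for u v
    using affine_function_vanishing_on_line[of a p "- c" q u v] pq by simp
  have nz: "orient p q z \<noteq> 0" if "z extreme_point_of P" "z \<notin> {p, q}" for z
  proof
    assume "orient p q z = 0"
    then have 0: "orient p q u = 0" for u using proportional[of z u] strict[OF that] by simp
    \<comment> \<open>The test point is \<open>p\<close> plus \<open>q - p\<close> turned by a right
      angle.\<close>
    have "orient p q (p + vector [- (q - p) $ 2, (q - p) $ 1]) =
        ((q - p) $ 1)\<^sup>2 + ((q - p) $ 2)\<^sup>2"
      by (simp add: orient_def power2_eq_square algebra_simps)
    then have "(q - p) $ 1 = 0 \<and> (q - p) $ 2 = 0" using 0 by (simp add: sum_power2_eq_zero_iff)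
    then show False using assms(3) by (simp add: vec_eq_iff forall_2)
  qed
  have "0 < (a \<bullet> x - c) * (a \<bullet> y - c)"
    using strict assms by (intro mult_neg_neg) auto
  then have "0 < (a \<bullet> x - c) * (a \<bullet> y - c) * (orient p q x)\<^sup>2"
    using nz assms by simp
  also have "\<dots> = (a \<bullet> x - c)\<^sup>2 * (orient p q x * orient p q y)"
    using proportional[of x y] by (simp add: power2_eq_square mult_ac)
  finally show ?thesis by (simp add: zero_less_mult_iff)
qed

text \<open>Each edge has all other vertices on one side by \<open>edge_same_side\<close>; the sign
  passes from edge to edge because neighbouring edges span a common triangle.\<close>

lemma convex_ngon_convex_cycle:
  assumes "4 \<le> n" "convex_ngon n P V"
  obtains s where "convex_cycle n (cyc n V) s"
proof -
  note P = assms(2)[unfolded convex_ngon_def]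
  define W where "W = cyc n V"
  have per: "W (i + n) = W i" for i by (simp add: W_def cyc_def)
  have ext: "W i extreme_point_of P" for i
    using P assms(1) unfolding W_def cyc_def by (metis (mono_tags, lifting) imageI lessThan_iff
        mem_Collect_eq mod_less_divisor less_le_trans zero_less_numeral)
  have inj: "W i = W j \<longleftrightarrow> i mod n = j mod n" for i j
    using P assms(1) unfolding W_def cyc_def inj_on_def by auto
  have neq: "W (i + d) \<noteq> W i" if "0 < d" "d < n" for i d
    using inj mod_add_neq[OF that] by blast
  have edge: "closed_segment (W i) (W (i + 1)) edge_of P" for i
  proof -
    have "closed_segment (W (i mod n)) (W (i mod n + 1)) edge_of P"
      using P assms(1) unfolding W_def by simp
    moreover have "W (i mod n) = W i" "W (i mod n + 1) = W (i + 1)"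
      by (simp_all add: W_def cyc_def mod_Suc_eq)
    ultimately show ?thesis by simp
  qed
  have side: "0 < orient (W i) (W (i + 1)) (W (i + d)) * orient (W i) (W (i + 1)) (W (i + e))"
    if "2 \<le> d" "d < n" "2 \<le> e" "e < n" for i d e
    using that neq[of 1 i] neq[of d i] neq[of e i] neq[of "d - 1" "i + 1"] neq[of "e - 1" "i + 1"]
    by (intro edge_same_side[OF _ edge]) (use P ext in auto)
  define s where "s = orient (W 0) (W 1) (W 2)"
  have s: "0 < s * orient (W i) (W (i + 1)) (W (i + 2))" for i
  proof (induction i)
    case 0
    then show ?case using side[of 2 2 0] assms(1) by (simp add: s_def numeral_2_eq_2)
  next
    case (Suc i)
    \<comment> \<open>Seen from edge \<open>i + 1\<close>, the vertex \<open>W i\<close> has offset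
      \<open>n - 1\<close>; it lies on the same side as \<open>W (i + 3)\<close>.\<close>
    have "W (i + 1 + (n - 1)) = W i" using per[of i] assms(1) by simp
    then have "0 < orient (W i) (W (i + 1)) (W (i + 2)) *
        orient (W (i + 1)) (W (i + 2)) (W (i + 3))"
      using side[of "n - 1" 2 "i + 1"] assms(1) orient_rotate[of "W (i + 1)" "W (i + 2)" "W i"]
      by (simp add: numeral_3_eq_3)
    then show ?case using Suc by (auto simp: zero_less_mult_iff numeral_3_eq_3)
  qed
  have "0 < s * orient (W i) (W (i + 1)) (W (i + d))" if "2 \<le> d" "d < n" for i d
    using s[of i] side[of 2 d i] that assms(1) by (auto simp: zero_less_mult_iff)
  then show thesis
    using that[of s] assms(1) per unfolding W_def by (simp add: convex_cycle_def)
qed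

theorem theorem2p2:
  fixes n :: nat and P :: "(real ^ 2) set" and V :: "nat \<Rightarrow> real ^ 2"
  assumes "n \<ge> 4"
    and "convex_ngon n P V"
  shows "card {i. i < n \<and> extremal_triple n V i} \<ge> 4"
proof -
  obtain s where "convex_cycle n (cyc n V) s" using convex_ngon_convex_cycle assms by blast
  then interpret convex_cycle n "cyc n V" s .
  obtain E where "E \<subseteq> {..<n}" "4 \<le> card E" "\<And>i. i \<in> E \<Longrightarrow> extremal_triple n V i"
    using four_extremal_triples unfolding extremal_triple_def by blast
  then have "card E \<le> card {i. i < n \<and> extremal_triple n V i}" by (intro card_mono) auto
  then show ?thesis using \<open>4 \<le> card E\<close> by simp
qed

end
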